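(* There is a polynomial-time algorithm that, given any $s\in\mathbb{N}$ and any sequence of $s$ closed intervals $[a_1,b_1],\dots,[a_s,b_s]$ (with $a_i\le b_i$) whose left endpoints satisfy $a_1<a_2<\dots<a_s$, computes an assignment $(\hat I_1,\dots,\hat I_s)\in\mathbb{N}^s$ of positive integers satisfying all three of the following properties, where $\mathcal{N}_i=\{j\in[s]:a_i\in[a_j,b_j]\}$ for $i\in[s]$: (i) (Local dominance) For each $i\in[s]$ there exists a bijection $\rho_i:\mathcal{N}_i\to\{1,2,\dots,|\mathcal{N}_i|\}$ such that $\hat I_j\ge\rho_i(j)$ for all $j\in\mathcal{N}_i$. (ii) (Global dominance) For every decreasing and concave function $\bar\Psi:[1,\infty)\to\mathbb{R}$, $$\sum_{i\in[s]}\bar\Psi(\hat I_i)\ \ge\ \sum_{i\in[s]}\bar\Psi(|\mathcal{N}_i|).$$ (iii) (Partition monotonicity) The index set $[s]$ can be partitioned into disjoint subsets $A_1,\dots,A_\kappa$ such that for each $\ell\in[\kappa]$, $\{\hat I_i:i\in A_\ell\}=\{1,2,\dots,|A_\ell|\}$.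
   Context: Notation: $[s]=\{1,2,\dots,s\}$ and $\mathbb{N}=\{1,2,\dots\}$. The set $\mathcal{N}_i$ (the coverage set of index $i$) is the set of indices of intervals that contain the left endpoint $a_i$, and $|\mathcal{N}_i|$ is its cardinality; note $i\in\mathcal{N}_i$. "Decreasing" means non-increasing. The task of finding an assignment with properties (i)–(iii) is called the Interval Assignment Problem. *)

theory Defs
  imports "HOL-Analysis.Analysis" "HOL-Computational_Algebra.Polynomial" "HOL-Library.Disjoint_Sets"
begin

section \<open>Model of computation\<close>

text \<open>
  Intervals have real endpoints, so algorithms are WHILE programs on a real RAM with two
  memories: one of natural numbers (used for control, indices and the output) and one of real
  numbers. Both are addressed by computed natural numbers. Reals cannot be converted to naturals;
  they influence the computation only through comparisons.

  Every command and every test costs one step. Arithmetic is restricted to addition and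
  subtraction on both sorts: with unit-cost multiplication, repeated squaring would produce
  numbers of exponential length. As it is, on rational inputs the numbers occurring in a run of
  \<open>t\<close> steps have bit length polynomial in \<open>t\<close> and the length of the input, so polynomially many
  steps here mean polynomial time on a Turing machine. Nested expressions are evaluated within
  one step, which only hides a constant factor that depends on the program.
\<close>

datatype nexp =
    NConst nat
  | NLoad nexp
  | NPlus nexp nexp
  | NMinus nexp nexp

datatype rexp =
    RLoad nexp
  | RPlus rexp rexp
  | RMinus rexp rexp

datatype bexp =
    NLess nexp nexp
  | RLess rexp rexp
  | BNot bexp
  | BAnd bexp bexp

datatype com =
    Skip
  | NStore nexp nexp
  | RStore nexp rexp
  | Seq com com
  | Cond bexp com com
  | While bexp com

type_synonym state = "(nat \<Rightarrow> nat) \<times> (nat \<Rightarrow> real)"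

primrec nval :: "nexp \<Rightarrow> state \<Rightarrow> nat" where
  "nval (NConst n) \<sigma> = n"
| "nval (NLoad e) \<sigma> = fst \<sigma> (nval e \<sigma>)"
| "nval (NPlus e e') \<sigma> = nval e \<sigma> + nval e' \<sigma>"
| "nval (NMinus e e') \<sigma> = nval e \<sigma> - nval e' \<sigma>"

primrec rval :: "rexp \<Rightarrow> state \<Rightarrow> real" where
  "rval (RLoad e) \<sigma> = snd \<sigma> (nval e \<sigma>)"
| "rval (RPlus e e') \<sigma> = rval e \<sigma> + rval e' \<sigma>"
| "rval (RMinus e e') \<sigma> = rval e \<sigma> - rval e' \<sigma>"

primrec bval :: "bexp \<Rightarrow> state \<Rightarrow> bool" where
  "bval (NLess e e') \<sigma> \<longleftrightarrow> nval e \<sigma> < nval e' \<sigma>"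
| "bval (RLess e e') \<sigma> \<longleftrightarrow> rval e \<sigma> < rval e' \<sigma>"
| "bval (BNot c) \<sigma> \<longleftrightarrow> \<not> bval c \<sigma>"
| "bval (BAnd c c') \<sigma> \<longleftrightarrow> bval c \<sigma> \<and> bval c' \<sigma>"

text \<open>\<open>exec c \<sigma> t \<sigma>'\<close>: started in \<open>\<sigma>\<close>, the program \<open>c\<close> halts after \<open>t\<close> steps in \<open>\<sigma>'\<close>.\<close>

inductive exec :: "com \<Rightarrow> state \<Rightarrow> nat \<Rightarrow> state \<Rightarrow> bool" where
  Skip: "exec Skip \<sigma> 1 \<sigma>"
| NStore: "exec (NStore e e') \<sigma> 1 ((fst \<sigma>)(nval e \<sigma> := nval e' \<sigma>), snd \<sigma>)"
| RStore: "exec (RStore e e') \<sigma> 1 (fst \<sigma>, (snd \<sigma>)(nval e \<sigma> := rval e' \<sigma>))"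
| Seq: "exec c \<sigma> t \<sigma>' \<Longrightarrow> exec c' \<sigma>' t' \<sigma>'' \<Longrightarrow> exec (Seq c c') \<sigma> (t + t') \<sigma>''"
| CondTrue: "bval g \<sigma> \<Longrightarrow> exec c \<sigma> t \<sigma>' \<Longrightarrow> exec (Cond g c c') \<sigma> (1 + t) \<sigma>'"
| CondFalse: "\<not> bval g \<sigma> \<Longrightarrow> exec c' \<sigma> t \<sigma>' \<Longrightarrow> exec (Cond g c c') \<sigma> (1 + t) \<sigma>'"
| WhileFalse: "\<not> bval g \<sigma> \<Longrightarrow> exec (While g c) \<sigma> 1 \<sigma>"
| WhileTrue: "bval g \<sigma> \<Longrightarrow> exec c \<sigma> t \<sigma>' \<Longrightarrow> exec (While g c) \<sigma>' t' \<sigma>''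
    \<Longrightarrow> exec (While g c) \<sigma> (1 + t + t') \<sigma>''"

text \<open>The relation is deterministic, so a program has at most one halting run per input.\<close>

inductive_cases SkipE: "exec Skip \<sigma> t \<sigma>'"
inductive_cases NStoreE: "exec (NStore e e') \<sigma> t \<sigma>'"
inductive_cases RStoreE: "exec (RStore e e') \<sigma> t \<sigma>'"
inductive_cases SeqE: "exec (Seq c c') \<sigma> t \<sigma>'"
inductive_cases CondE: "exec (Cond g c c') \<sigma> t \<sigma>'"
inductive_cases WhileE: "exec (While g c) \<sigma> t \<sigma>'"

lemma exec_deterministic:
  "exec c \<sigma> t \<sigma>' \<Longrightarrow> exec c \<sigma> u \<tau> \<Longrightarrow> u = t \<and> \<tau> = \<sigma>'"
proof (induction arbitrary: u \<tau> rule: exec.induct)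
  case (Skip \<sigma>)
  from Skip.prems show ?case by (rule SkipE) simp
next
  case (NStore e e' \<sigma>)
  from NStore.prems show ?case by (rule NStoreE) simp
next
  case (RStore e e' \<sigma>)
  from RStore.prems show ?case by (rule RStoreE) simp
next
  case (Seq c \<sigma> t \<sigma>' c' t' \<sigma>'')
  from Seq.prems show ?case by (rule SeqE) (metis Seq.IH)
next
  case (CondTrue g \<sigma> c t \<sigma>' c')
  from CondTrue.prems show ?case by (rule CondE) (metis CondTrue.IH CondTrue.hyps(1) plus_1_eq_Suc add_Suc)+
next
  case (CondFalse g \<sigma> c' t \<sigma>' c)
  from CondFalse.prems show ?case by (rule CondE) (metis CondFalse.IH CondFalse.hyps(1) plus_1_eq_Suc add_Suc)+
next
  case (WhileFalse g \<sigma> c)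
  from WhileFalse.prems show ?case by (rule WhileE) (simp_all add: WhileFalse.hyps)
next
  case (WhileTrue g \<sigma> c t \<sigma>' t' \<sigma>'')
  from WhileTrue.prems show ?case by (rule WhileE) (metis WhileTrue.IH WhileTrue.hyps(1) plus_1_eq_Suc add_Suc)+
qed


section \<open>The Interval Assignment Problem\<close>

text \<open>Indices range over \<open>{1..s}\<close>; values of \<open>a\<close>, \<open>b\<close> and \<open>I\<close> elsewhere are irrelevant.\<close>

definition interval_instance :: "nat \<Rightarrow> (nat \<Rightarrow> real) \<Rightarrow> (nat \<Rightarrow> real) \<Rightarrow> bool" where
  "interval_instance s a b \<longleftrightarrow>
     1 \<le> s \<and> (\<forall>i\<in>{1..s}. a i \<le> b i) \<and> strict_mono_on {1..s} a"

definition coverage :: "nat \<Rightarrow> (nat \<Rightarrow> real) \<Rightarrow> (nat \<Rightarrow> real) \<Rightarrow> nat \<Rightarrow> nat set" where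
  "coverage s a b i = {j \<in> {1..s}. a i \<in> {a j..b j}}"

definition local_dominance ::
    "nat \<Rightarrow> (nat \<Rightarrow> real) \<Rightarrow> (nat \<Rightarrow> real) \<Rightarrow> (nat \<Rightarrow> nat) \<Rightarrow> bool" where
  "local_dominance s a b I \<longleftrightarrow>
     (\<forall>i\<in>{1..s}. \<exists>\<rho>. bij_betw \<rho> (coverage s a b i) {1..card (coverage s a b i)} \<and>
        (\<forall>j\<in>coverage s a b i. I j \<ge> \<rho> j))"

definition global_dominance ::
    "nat \<Rightarrow> (nat \<Rightarrow> real) \<Rightarrow> (nat \<Rightarrow> real) \<Rightarrow> (nat \<Rightarrow> nat) \<Rightarrow> bool" where
  "global_dominance s a b I \<longleftrightarrow>
     (\<forall>\<Psi> :: real \<Rightarrow> real. antimono_on {1..} \<Psi> \<and> concave_on {1..} \<Psi> \<longrightarrow>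
        (\<Sum>i\<in>{1..s}. \<Psi> (real (I i))) \<ge> (\<Sum>i\<in>{1..s}. \<Psi> (real (card (coverage s a b i)))))"

definition partition_monotonicity :: "nat \<Rightarrow> (nat \<Rightarrow> nat) \<Rightarrow> bool" where
  "partition_monotonicity s I \<longleftrightarrow>
     (\<exists>P. partition_on {1..s} P \<and> (\<forall>A\<in>P. I ` A = {1..card A}))"

text \<open>
  Input: \<open>s\<close> is in cell 0 of the natural-number memory, and \<open>a i\<close>, \<open>b i\<close> are in cells \<open>2 * i\<close> and
  \<open>2 * i + 1\<close> of the real memory for \<open>i \<in> {1..s}\<close>; all other cells are 0.
  Output: the value assigned to \<open>i\<close> is in cell \<open>i\<close> of the natural-number memory.
\<close>

definition input_state :: "nat \<Rightarrow> (nat \<Rightarrow> real) \<Rightarrow> (nat \<Rightarrow> real) \<Rightarrow> state" where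
  "input_state s a b =
     (\<lambda>k. if k = 0 then s else 0,
      \<lambda>k. if k div 2 \<in> {1..s} then (if even k then a (k div 2) else b (k div 2)) else 0)"

definition assignment :: "state \<Rightarrow> nat \<Rightarrow> nat" where
  "assignment \<sigma> i = fst \<sigma> i"

end

theory Submission
  imports Defs
begin

text \<open>
  Colour the intervals first-fit in the order of their left endpoints. The colour of \<open>i\<close> differs from
  those of the other members of \<open>\<N>\<^sub>i\<close> and is at most \<open>\<bar>\<N>\<^sub>i\<bar>\<close>. Then rename the colours so that the
  class sizes decrease. Distinct positive values on \<open>\<N>\<^sub>i\<close> give local dominance. Let \<open>A\<^sub>t\<close> collect the
  \<open>t\<close>-th element of every colour class that has one. As the classes are sorted by size, the new
  colours occurring in \<open>A\<^sub>t\<close> form an initial segment, which is partition monotonicity. The old colours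
  are distinct on \<open>A\<^sub>t\<close>, so a decreasing function has on them at most the sum that it has on
  \<open>{1..\<bar>A\<^sub>t\<bar>}\<close>; summing over \<open>t\<close> gives global dominance.
\<close>

section \<open>Ranks\<close>

text \<open>A strictly larger element has strictly more predecessors, so the counts are distinct;
  totality makes every element its own predecessor, so they are at least 1. The relation is a
  parameter because the lemma serves values of a function, positions inside a colour class and the
  order of colours by class size.\<close>

lemma bij_betw_card_predecessors:
  assumes fin: "finite A"
    and total: "\<And>x y. x \<in> A \<Longrightarrow> y \<in> A \<Longrightarrow> L x y \<or> L y x"
    and antisym: "\<And>x y. x \<in> A \<Longrightarrow> y \<in> A \<Longrightarrow> L x y \<Longrightarrow> L y x \<Longrightarrow> x = y"
    and trans: "\<And>x y z. x \<in> A \<Longrightarrow> y \<in> A \<Longrightarrow> z \<in> A \<Longrightarrow> L x y \<Longrightarrow> L y z \<Longrightarrow> L x z"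
  shows "bij_betw (\<lambda>x. card {y \<in> A. L y x}) A {1..card A}"
proof -
  let ?r = "\<lambda>x. card {y \<in> A. L y x}"
  have less: "?r x < ?r y" if "x \<in> A" "y \<in> A" "L x y" "x \<noteq> y" for x y
  proof (rule psubset_card_mono)
    have "y \<notin> {z \<in> A. L z x}" "y \<in> {z \<in> A. L z y}"
      using that antisym total by blast+
    moreover have "{z \<in> A. L z x} \<subseteq> {z \<in> A. L z y}"
      using that trans by blast
    ultimately show "{z \<in> A. L z x} \<subset> {z \<in> A. L z y}" by blast
  qed (simp add: fin)
  have inj: "inj_on ?r A"
    by (rule inj_onI) (metis less less_irrefl total)
  have "?r x \<in> {1..card A}" if "x \<in> A" for x
  proof -
    have "x \<in> {y \<in> A. L y x}" using that total by blast
    then have "0 < ?r x" using fin by (auto simp: card_gt_0_iff)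
    moreover have "?r x \<le> card A" by (intro card_mono fin) auto
    ultimately show ?thesis by simp
  qed
  then have "?r ` A \<subseteq> {1..card A}" by blast
  moreover have "card (?r ` A) = card {1..card A}" using inj by (simp add: card_image)
  ultimately have "?r ` A = {1..card A}" by (simp add: card_subset_eq)
  with inj show ?thesis by (simp add: bij_betw_def)
qed

text \<open>The rank of \<open>x\<close> counts the elements with value at most \<open>f x\<close>,
  and \<open>f\<close> maps these injectively into \<open>{1..f x}\<close>.\<close>

lemma ex_bij_betw_rank_le:
  fixes f :: "'a \<Rightarrow> nat"
  assumes fin: "finite A" and inj: "inj_on f A" and pos: "\<And>x. x \<in> A \<Longrightarrow> 1 \<le> f x"
  shows "\<exists>\<rho>. bij_betw \<rho> A {1..card A} \<and> (\<forall>x\<in>A. \<rho> x \<le> f x)"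
proof (intro exI conjI ballI)
  let ?r = "\<lambda>x. card {y \<in> A. f y \<le> f x}"
  show "bij_betw ?r A {1..card A}"
    by (rule bij_betw_card_predecessors) (use fin inj in \<open>auto simp: inj_on_def\<close>)
  fix x assume "x \<in> A"
  have "?r x = card (f ` {y \<in> A. f y \<le> f x})"
    by (rule card_image[symmetric], rule inj_on_subset[OF inj]) blast
  also have "\<dots> \<le> card {1..f x}"
    by (rule card_mono) (use pos in auto)
  finally show "?r x \<le> f x" by simp
qed

text \<open>Replacing \<open>f\<close> by a rank below it only lowers the arguments of \<Psi>, and
  the ranks run through \<open>{1..card A}\<close> exactly once.\<close>

lemma sum_antimono_le_initial_segment:
  fixes f :: "'a \<Rightarrow> nat" and \<Psi> :: "real \<Rightarrow> real"
  assumes fin: "finite A" and inj: "inj_on f A" and pos: "\<And>x. x \<in> A \<Longrightarrow> 1 \<le> f x"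
    and anti: "antimono_on {1..} \<Psi>"
  shows "(\<Sum>x\<in>A. \<Psi> (real (f x))) \<le> (\<Sum>r=1..card A. \<Psi> (real r))"
proof -
  obtain \<rho> where \<rho>: "bij_betw \<rho> A {1..card A}" "\<And>x. x \<in> A \<Longrightarrow> \<rho> x \<le> f x"
    using ex_bij_betw_rank_le[OF fin inj pos] by blast
  have "(\<Sum>x\<in>A. \<Psi> (real (f x))) \<le> (\<Sum>x\<in>A. \<Psi> (real (\<rho> x)))"
  proof (rule sum_mono)
    fix x assume x: "x \<in> A"
    then have "1 \<le> \<rho> x" using \<rho>(1) by (auto dest: bij_betwE)
    then show "\<Psi> (real (f x)) \<le> \<Psi> (real (\<rho> x))"
      using \<rho>(2)[OF x] by (intro monotone_onD[OF anti]) auto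
  qed
  also have "\<dots> = (\<Sum>r=1..card A. \<Psi> (real r))"
    by (rule sum.reindex_bij_betw[OF \<rho>(1)])
  finally show ?thesis .
qed

lemma down_closed_eq_initial_segment:
  fixes X :: "nat set"
  assumes fin: "finite X" and pos: "\<And>x. x \<in> X \<Longrightarrow> 1 \<le> x"
    and down: "\<And>x y. x \<in> X \<Longrightarrow> 1 \<le> y \<Longrightarrow> y < x \<Longrightarrow> y \<in> X"
  shows "X = {1..card X}"
proof (cases "X = {}")
  case False
  have "X = {1..Max X}"
  proof
    show "X \<subseteq> {1..Max X}" using fin pos by auto
    show "{1..Max X} \<subseteq> X"
    proof
      fix y assume "y \<in> {1..Max X}"
      then show "y \<in> X" using down[OF Max_in[OF fin False]] Max_in[OF fin False]
        by (cases "y = Max X") auto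
    qed
  qed
  then show ?thesis by (metis card_atLeastAtMost diff_Suc_1)
qed simp

section \<open>Relabelling a colouring by decreasing class size\<close>

definition class_size :: "nat \<Rightarrow> (nat \<Rightarrow> nat) \<Rightarrow> nat \<Rightarrow> nat" where
  "class_size s C k = card {i \<in> {1..s}. C i = k}"

text \<open>Breaking ties by the colour itself makes the order antisymmetric, so that distinct
  colours get distinct ranks.\<close>

definition precedes :: "nat \<Rightarrow> (nat \<Rightarrow> nat) \<Rightarrow> nat \<Rightarrow> nat \<Rightarrow> bool" where
  "precedes s C k l \<longleftrightarrow>
     class_size s C l < class_size s C k \<or> class_size s C k = class_size s C l \<and> k \<le> l"

definition colour_rank :: "nat \<Rightarrow> (nat \<Rightarrow> nat) \<Rightarrow> nat \<Rightarrow> nat" where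
  "colour_rank s C l = card {k \<in> {1..s}. precedes s C k l}"

lemma bij_betw_colour_rank: "bij_betw (colour_rank s C) {1..s} {1..s}"
proof -
  have "bij_betw (\<lambda>l. card {k \<in> {1..s}. precedes s C k l}) {1..s} {1..card {1..s}}"
    by (rule bij_betw_card_predecessors) (auto simp: precedes_def)
  then show ?thesis by (simp add: colour_rank_def[abs_def])
qed

text \<open>If the class of \<open>l\<close> were strictly larger, every colour preceding
  \<open>l\<close> would precede \<open>k\<close> as well.\<close>

lemma class_size_antimono_colour_rank:
  assumes "colour_rank s C k < colour_rank s C l"
  shows "class_size s C l \<le> class_size s C k"
proof (rule ccontr)
  assume "\<not> class_size s C l \<le> class_size s C k"
  then have "{m \<in> {1..s}. precedes s C m l} \<subseteq> {m \<in> {1..s}. precedes s C m k}"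
    by (auto simp: precedes_def)
  then have "colour_rank s C l \<le> colour_rank s C k"
    unfolding colour_rank_def by (rule card_mono[rotated]) simp
  with assms show False by simp
qed

text \<open>Partition monotonicity and global dominance are read off the same parts, so one
  existence statement carries both facts about them.\<close>

lemma ex_transversal_partition:
  assumes C: "\<And>i. i \<in> {1..s} \<Longrightarrow> C i \<in> {1..s}"
  shows "\<exists>P. partition_on {1..s} P \<and>
    (\<forall>A\<in>P. inj_on C A \<and> (colour_rank s C \<circ> C) ` A = {1..card A})"
proof -
  let ?R = "colour_rank s C"
  \<comment> \<open>The parts will be the level sets of \<open>pos\<close>, the position of an index
    within its own colour class.\<close>
  define pos where "pos i = card {j \<in> {j \<in> {1..s}. C j = C i}. j \<le> i}" for i
  have pos: "bij_betw pos {j \<in> {1..s}. C j = k} {1..class_size s C k}" for k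
  proof -
    have "bij_betw (\<lambda>i. card {j \<in> {j \<in> {1..s}. C j = k}. j \<le> i}) {j \<in> {1..s}. C j = k}
      {1..class_size s C k}"
      unfolding class_size_def by (rule bij_betw_card_predecessors) auto
    then show ?thesis
      by (rule bij_betw_cong[THEN iffD1, rotated]) (auto simp: pos_def)
  qed
  let ?A = "\<lambda>t. {i \<in> {1..s}. pos i = t}"
  have inj: "inj_on C (?A t)" for t
  proof (rule inj_onI)
    fix i j assume "i \<in> ?A t" "j \<in> ?A t" "C i = C j"
    then show "i = j"
      using bij_betw_imp_inj_on[OF pos[of "C j"]] by (auto dest: inj_onD)
  qed
  have R: "?R k \<in> {1..s}" if "k \<in> {1..s}" for k
    using bij_betw_colour_rank that by (rule bij_betw_apply)
  have img: "(?R \<circ> C) ` ?A t = {1..card (?A t)}" for t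
  proof -
    have "C ` ?A t \<subseteq> {1..s}" using C by blast
    then have "inj_on (?R \<circ> C) (?A t)"
      by (intro comp_inj_on[OF inj] inj_on_subset[OF bij_betw_imp_inj_on[OF bij_betw_colour_rank]])
    then have card: "card ((?R \<circ> C) ` ?A t) = card (?A t)" by (rule card_image)
    have "(?R \<circ> C) ` ?A t = {1..card ((?R \<circ> C) ` ?A t)}"
    proof (rule down_closed_eq_initial_segment)
      show "1 \<le> r" if "r \<in> (?R \<circ> C) ` ?A t" for r
      proof -
        from that obtain i where "i \<in> {1..s}" "r = ?R (C i)" by auto
        then show ?thesis using R[OF C] by simp
      qed
    next
      fix r q assume r: "r \<in> (?R \<circ> C) ` ?A t" and q: "1 \<le> q" "q < r"
      from r obtain i where i: "i \<in> {1..s}" "pos i = t" "r = ?R (C i)" by auto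
      have "q \<in> {1..s}" using q i R[OF C[OF i(1)]] by auto
      then obtain k where k: "k \<in> {1..s}" "q = ?R k"
        using bij_betw_imp_surj_on[OF bij_betw_colour_rank] by (metis imageE)
      \<comment> \<open>The class of \<open>C i\<close> has a \<open>t\<close>-th element. The class
        of the better ranked colour \<open>k\<close> is at least as large, so it has one too, and
        that element has new colour \<open>q\<close>.\<close>
      have "t \<in> {1..class_size s C (C i)}"
        using bij_betw_apply[OF pos, of i "C i"] i by auto
      moreover have "class_size s C (C i) \<le> class_size s C k"
        using class_size_antimono_colour_rank q i k by blast
      ultimately have "t \<in> pos ` {j \<in> {1..s}. C j = k}"
        unfolding bij_betw_imp_surj_on[OF pos] by simp
      then show "q \<in> (?R \<circ> C) ` ?A t" using k by auto
    qed simp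
    with card show ?thesis by simp
  qed
  \<comment> \<open>Only positions that occur index the parts, since a partition has no empty
    part.\<close>
  let ?P = "?A ` pos ` {1..s}"
  have "partition_on {1..s} ?P"
    by (rule partition_onI) (auto simp: disjnt_def)
  moreover have "\<forall>A\<in>?P. inj_on C A \<and> (?R \<circ> C) ` A = {1..card A}"
    using inj img by blast
  ultimately show ?thesis by blast
qed

lemma partition_monotonicity_relabelled:
  assumes "\<And>i. i \<in> {1..s} \<Longrightarrow> C i \<in> {1..s}"
    and I: "\<And>i. i \<in> {1..s} \<Longrightarrow> I i = colour_rank s C (C i)"
  shows "partition_monotonicity s I"
proof -
  obtain P where P: "partition_on {1..s} P" "\<forall>A\<in>P. (colour_rank s C \<circ> C) ` A = {1..card A}"
    using ex_transversal_partition[of s C, OF assms(1)] by blast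
  have "I ` A = (colour_rank s C \<circ> C) ` A" if "A \<in> P" for A
    by (rule image_cong) (use partition_onD1[OF P(1)] that I in auto)
  with P show ?thesis unfolding partition_monotonicity_def by metis
qed

text \<open>Within one part the new colours are exactly \<open>{1..card A}\<close>, and no other
  choice of \<open>card A\<close> distinct positive values, such as the old colours, gives a larger
  sum.\<close>

lemma sum_relabelled_ge:
  assumes C: "\<And>i. i \<in> {1..s} \<Longrightarrow> C i \<in> {1..s}" and anti: "antimono_on {1..} \<Psi>"
  shows "(\<Sum>i=1..s. \<Psi> (real (C i))) \<le> (\<Sum>i=1..s. \<Psi> (real (colour_rank s C (C i))) :: real)"
proof -
  let ?I = "colour_rank s C \<circ> C"
  obtain P where P: "partition_on {1..s} P" "\<And>A. A \<in> P \<Longrightarrow> inj_on C A"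
    "\<And>A. A \<in> P \<Longrightarrow> ?I ` A = {1..card A}"
    using ex_transversal_partition[of s C, OF C] by blast
  have fin: "\<forall>A\<in>P. finite A"
    using partition_onD1[OF P(1)] by (metis Union_upper finite_atLeastAtMost finite_subset)
  have dis: "\<forall>A\<in>P. \<forall>B\<in>P. A \<noteq> B \<longrightarrow> A \<inter> B = {}"
    using partition_onD2[OF P(1)] by (auto simp: disjoint_def)
  have split: "(\<Sum>i=1..s. g i) = (\<Sum>A\<in>P. \<Sum>i\<in>A. g i)" for g :: "nat \<Rightarrow> real"
    unfolding partition_onD1[OF P(1)] using sum.Union_disjoint[OF fin dis, of g] by simp
  have "(\<Sum>i\<in>A. \<Psi> (real (C i))) \<le> (\<Sum>i\<in>A. \<Psi> (real (?I i)))" if A: "A \<in> P" for A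
  proof -
    have "1 \<le> C i" if "i \<in> A" for i
      by (metis C UnionI A that partition_onD1[OF P(1)] atLeastAtMost_iff)
    then have "(\<Sum>i\<in>A. \<Psi> (real (C i))) \<le> (\<Sum>r=1..card A. \<Psi> (real r))"
      using A fin P(2) anti by (intro sum_antimono_le_initial_segment) auto
    also have "\<dots> = (\<Sum>i\<in>A. \<Psi> (real (?I i)))"
    proof -
      \<comment> \<open>An image of full cardinality forces \<open>?I\<close> to be injective on
        \<open>A\<close>.\<close>
      have "bij_betw ?I A {1..card A}"
        unfolding bij_betw_def using A P(3) fin by (auto intro!: eq_card_imp_inj_on)
      from sum.reindex_bij_betw[OF this, of "\<lambda>r. \<Psi> (real r)"] show ?thesis by simp
    qed
    finally show ?thesis .
  qed
  then show ?thesis unfolding split by (auto intro: sum_mono)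
qed

section \<open>First-fit colourings\<close>

text \<open>First-fit is split in two: while the program raises a colour it maintains
  \<open>first_fit_at\<close> throughout, but reaches \<open>free_at\<close> only at the
  end.\<close>

definition first_fit_at :: "nat \<Rightarrow> (nat \<Rightarrow> real) \<Rightarrow> (nat \<Rightarrow> real) \<Rightarrow> (nat \<Rightarrow> nat) \<Rightarrow> nat \<Rightarrow> bool" where
  "first_fit_at s a b C i \<longleftrightarrow> 1 \<le> C i \<and> {1..<C i} \<subseteq> C ` (coverage s a b i - {i})"

definition free_at :: "nat \<Rightarrow> (nat \<Rightarrow> real) \<Rightarrow> (nat \<Rightarrow> real) \<Rightarrow> (nat \<Rightarrow> nat) \<Rightarrow> nat \<Rightarrow> bool" where
  "free_at s a b C i \<longleftrightarrow> C i \<notin> C ` (coverage s a b i - {i})"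

lemma finite_coverage [simp]: "finite (coverage s a b i)"
  by (simp add: coverage_def)

text \<open>Left endpoints increase strictly, so besides \<open>i\<close> only earlier intervals can
  contain \<open>a i\<close>. This is what makes colouring in index order possible.\<close>

lemma coverage_eq:
  assumes "interval_instance s a b" "i \<in> {1..s}"
  shows "coverage s a b i = insert i {j \<in> {1..<i}. a i \<le> b j}"
proof -
  have "j \<le> i" if "j \<in> {1..s}" "a j \<le> a i" for j
    using assms that unfolding interval_instance_def
    by (metis strict_mono_onD linorder_not_le)
  moreover have "a j \<le> a i" if "j \<in> {1..<i}" for j
    using assms that unfolding interval_instance_def
    by (intro less_imp_le) (auto elim!: strict_mono_onD)
  ultimately show ?thesis
    using assms unfolding coverage_def interval_instance_def by fastforce
qed

text \<open>The \<open>C i - 1\<close> smaller colours all occur on the coverage set without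
  \<open>i\<close>, so that set has at least as many elements.\<close>

lemma first_fit_at_le_card_coverage:
  assumes "interval_instance s a b" "i \<in> {1..s}" "first_fit_at s a b C i"
  shows "C i \<le> card (coverage s a b i)" "C i \<le> s"
proof -
  let ?N = "coverage s a b i"
  have i: "i \<in> ?N" using coverage_eq[OF assms(1,2)] by simp
  have "C i - 1 \<le> card (C ` (?N - {i}))"
    using card_mono[of "C ` (?N - {i})" "{1..<C i}"] assms(3) by (simp add: first_fit_at_def)
  also have "\<dots> \<le> card (?N - {i})" by (rule card_image_le) simp
  also have "\<dots> = card ?N - 1" using i by simp
  finally have "C i - 1 \<le> card ?N - 1" .
  moreover have "0 < card ?N" using i by (auto simp: card_gt_0_iff)
  ultimately show le: "C i \<le> card ?N" by simp
  have "card ?N \<le> card {1..s}" by (rule card_mono) (auto simp: coverage_def)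
  with le show "C i \<le> s" by simp
qed

text \<open>If \<open>j < k\<close> both cover \<open>a i\<close>, then
  \<open>a k \<le> a i \<le> b j\<close>, so \<open>j\<close> covers \<open>a k\<close> and
  \<open>k\<close> avoids the colour of \<open>j\<close>.\<close>

lemma inj_on_coverage:
  assumes inst: "interval_instance s a b" and i: "i \<in> {1..s}"
    and free: "\<And>i. i \<in> {1..s} \<Longrightarrow> free_at s a b C i"
  shows "inj_on C (coverage s a b i)"
proof (rule linorder_inj_onI')
  fix j k assume jk: "j \<in> coverage s a b i" "k \<in> coverage s a b i" "j < k"
  then have s: "j \<in> {1..s}" "k \<in> {1..s}" by (auto simp: coverage_def)
  have "a k \<le> a i" "a i \<le> b j" using jk by (auto simp: coverage_def)
  then have "j \<in> coverage s a b k - {k}"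
    using jk s coverage_eq[OF inst s(2)] by auto
  with free[OF s(2)] show "C j \<noteq> C k" unfolding free_at_def by (metis imageI)
qed

lemma dominance_relabelled:
  assumes inst: "interval_instance s a b"
    and ff: "\<And>i. i \<in> {1..s} \<Longrightarrow> first_fit_at s a b C i"
    and free: "\<And>i. i \<in> {1..s} \<Longrightarrow> free_at s a b C i"
    and I: "\<And>i. i \<in> {1..s} \<Longrightarrow> I i = colour_rank s C (C i)"
  shows "\<forall>i\<in>{1..s}. 1 \<le> I i" "local_dominance s a b I" "global_dominance s a b I"
    "partition_monotonicity s I"
proof -
  have C: "C i \<in> {1..s}" if "i \<in> {1..s}" for i
    using first_fit_at_le_card_coverage[OF inst that ff[OF that]] ff[OF that]
    by (auto simp: first_fit_at_def)
  show pos: "\<forall>i\<in>{1..s}. 1 \<le> I i"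
    using bij_betw_apply[OF bij_betw_colour_rank C] I by simp
  show "local_dominance s a b I"
    unfolding local_dominance_def
  proof
    fix i assume i: "i \<in> {1..s}"
    have sub: "coverage s a b i \<subseteq> {1..s}" by (auto simp: coverage_def)
    have "C ` coverage s a b i \<subseteq> {1..s}" using C sub by blast
    \<comment> \<open>Renaming permutes \<open>{1..s}\<close>, so colours stay distinct on the
      coverage set; ranking these distinct positive values gives the bijection.\<close>
    then have "inj_on (colour_rank s C \<circ> C) (coverage s a b i)"
      by (intro comp_inj_on[OF inj_on_coverage[OF inst i free]]
          inj_on_subset[OF bij_betw_imp_inj_on[OF bij_betw_colour_rank]])
    then have "inj_on I (coverage s a b i)"
      by (rule inj_on_cong[THEN iffD1, rotated]) (use sub I in auto)
    then show "\<exists>\<rho>. bij_betw \<rho> (coverage s a b i) {1..card (coverage s a b i)} \<and>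
        (\<forall>j\<in>coverage s a b i. \<rho> j \<le> I j)"
      using pos sub by (intro ex_bij_betw_rank_le) auto
  qed
  show "global_dominance s a b I"
    unfolding global_dominance_def
  proof (intro allI impI)
    fix \<Psi> :: "real \<Rightarrow> real" assume "antimono_on {1..} \<Psi> \<and> concave_on {1..} \<Psi>"
    then have anti: "antimono_on {1..} \<Psi>" by simp
    \<comment> \<open>The comparison with the old colours holds term by term. The one with the new
      colours holds only for the sums, as a single colour may grow under renaming.\<close>
    have "(\<Sum>i=1..s. \<Psi> (real (card (coverage s a b i)))) \<le> (\<Sum>i=1..s. \<Psi> (real (C i)))"
    proof (rule sum_mono)
      fix i assume i: "i \<in> {1..s}"
      show "\<Psi> (real (card (coverage s a b i))) \<le> \<Psi> (real (C i))"
        using first_fit_at_le_card_coverage[OF inst i ff[OF i]] C[OF i]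
        by (intro monotone_onD[OF anti]) auto
    qed
    also have "\<dots> \<le> (\<Sum>i=1..s. \<Psi> (real (I i)))"
      using sum_relabelled_ge[of s C, OF C anti] I by simp
    finally show "(\<Sum>i=1..s. \<Psi> (real (card (coverage s a b i)))) \<le> (\<Sum>i=1..s. \<Psi> (real (I i)))" .
  qed
  show "partition_monotonicity s I"
    using C I by (rule partition_monotonicity_relabelled)
qed

section \<open>Timed weakest preconditions\<close>

text \<open>A bound in place of the exact time lets both branches of a conditional and all
  iterations of a loop share one number.\<close>

definition runs :: "com \<Rightarrow> state \<Rightarrow> nat \<Rightarrow> (state \<Rightarrow> bool) \<Rightarrow> bool" where
  "runs c \<sigma> T Q \<longleftrightarrow> (\<exists>t \<sigma>'. exec c \<sigma> t \<sigma>' \<and> t \<le> T \<and> Q \<sigma>')"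

lemma runs_mono:
  "runs c \<sigma> T Q \<Longrightarrow> T \<le> T' \<Longrightarrow> (\<And>\<sigma>'. Q \<sigma>' \<Longrightarrow> Q' \<sigma>') \<Longrightarrow> runs c \<sigma> T' Q'"
  unfolding runs_def by (meson order_trans)

lemma runs_Skip: "Q \<sigma> \<Longrightarrow> 1 \<le> T \<Longrightarrow> runs Skip \<sigma> T Q"
  unfolding runs_def by (blast intro: exec.Skip)

lemma runs_NStore:
  "Q ((fst \<sigma>)(nval e \<sigma> := nval e' \<sigma>), snd \<sigma>) \<Longrightarrow> 1 \<le> T \<Longrightarrow> runs (NStore e e') \<sigma> T Q"
  unfolding runs_def by (blast intro: exec.NStore)

lemma runs_Seq:
  assumes "runs c \<sigma> T (\<lambda>\<sigma>'. runs c' \<sigma>' T' Q)"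
  shows "runs (Seq c c') \<sigma> (T + T') Q"
  using assms unfolding runs_def by (blast intro: exec.Seq add_mono)

lemma runs_Cond:
  assumes "bval g \<sigma> \<Longrightarrow> runs c \<sigma> T Q" "\<not> bval g \<sigma> \<Longrightarrow> runs c' \<sigma> T Q"
  shows "runs (Cond g c c') \<sigma> (1 + T) Q"
  using assms unfolding runs_def
  by (cases "bval g \<sigma>") (meson exec.CondTrue exec.CondFalse add_left_mono)+

text \<open>Cells \<open>1..s\<close> are reserved for the output, so the variables live right above them.\<close>

definition cell :: "nat \<Rightarrow> nexp" where
  "cell v = NPlus (NLoad (NConst 0)) (NConst v)"

definition for_loop :: "nat \<Rightarrow> com \<Rightarrow> com" where
  "for_loop v c = Seq (NStore (cell v) (NConst 1))
     (While (BNot (NLess (NLoad (NConst 0)) (NLoad (cell v))))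
       (Seq c (NStore (cell v) (NPlus (NLoad (cell v)) (NConst 1)))))"

text \<open>\<open>Inv i\<close> describes the state right after the counter has been set to
  \<open>i\<close>. The body must leave the counter intact; the increment is already built into its
  postcondition.\<close>

lemma runs_for_loop:
  assumes s: "fst \<sigma> 0 = s" and v: "1 \<le> v"
    and start: "Inv 1 ((fst \<sigma>)(s + v := 1), snd \<sigma>)"
    and counter: "\<And>i \<tau>. Inv i \<tau> \<Longrightarrow> fst \<tau> 0 = s \<and> fst \<tau> (s + v) = i"
    and body: "\<And>i \<tau>. 1 \<le> i \<Longrightarrow> i \<le> s \<Longrightarrow> Inv i \<tau> \<Longrightarrow>
      runs c \<tau> T (\<lambda>\<tau>'. fst \<tau>' 0 = s \<and> fst \<tau>' (s + v) = i \<and> Inv (Suc i) ((fst \<tau>')(s + v := Suc i), snd \<tau>'))"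
    and final: "\<And>\<tau>. Inv (Suc s) \<tau> \<Longrightarrow> Q \<tau>"
  shows "runs (for_loop v c) \<sigma> (2 + s * (T + 2)) Q"
proof -
  let ?g = "BNot (NLess (NLoad (NConst 0)) (NLoad (cell v)))"
  let ?inc = "NStore (cell v) (NPlus (NLoad (cell v)) (NConst 1))"
  \<comment> \<open>With \<open>n\<close> iterations left, each costs \<open>T\<close> plus a test
    and an increment; the extra 1 is the final failing test.\<close>
  have "runs (While ?g (Seq c ?inc)) \<tau> (1 + n * (T + 2)) Q"
    if "Inv i \<tau>" "1 \<le> i" "i + n = Suc s" for i n \<tau>
    using that
  proof (induction n arbitrary: i \<tau>)
    case 0
    then have "\<not> bval ?g \<tau>" using counter[of i \<tau>] by (simp add: cell_def)
    moreover have "Q \<tau>" using 0 final by simp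
    ultimately show ?case unfolding runs_def
      by (intro exI conjI) (rule exec.WhileFalse, assumption, auto)
  next
    case (Suc n)
    have "i \<le> s" using Suc.prems by simp
    then obtain t \<tau>' where t: "exec c \<tau> t \<tau>'" "t \<le> T" "fst \<tau>' 0 = s" "fst \<tau>' (s + v) = i"
      "Inv (Suc i) ((fst \<tau>')(s + v := Suc i), snd \<tau>')"
      using body[OF Suc.prems(2) _ Suc.prems(1)] unfolding runs_def by blast
    let ?\<tau> = "((fst \<tau>')(s + v := Suc i), snd \<tau>')"
    have "exec ?inc \<tau>' 1 ?\<tau>"
      using exec.NStore[of "cell v" "NPlus (NLoad (cell v)) (NConst 1)" \<tau>'] t by (simp add: cell_def)
    then have step: "exec (Seq c ?inc) \<tau> (t + 1) ?\<tau>" using t(1) by (rule exec.Seq[rotated])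
    have "runs (While ?g (Seq c ?inc)) ?\<tau> (1 + n * (T + 2)) Q"
      by (rule Suc.IH[OF t(5)]) (use Suc.prems in auto)
    then obtain u \<tau>'' where u: "exec (While ?g (Seq c ?inc)) ?\<tau> u \<tau>''" "u \<le> 1 + n * (T + 2)" "Q \<tau>''"
      unfolding runs_def by blast
    have "bval ?g \<tau>" using counter[OF Suc.prems(1)] \<open>i \<le> s\<close> by (simp add: cell_def)
    then have "exec (While ?g (Seq c ?inc)) \<tau> (1 + (t + 1) + u) \<tau>''"
      using step u(1) by (rule exec.WhileTrue)
    then show ?case unfolding runs_def using t(2) u(2,3) by (intro exI conjI) auto
  qed
  from this[OF start, of s]
  have "runs (While ?g (Seq c ?inc)) ((fst \<sigma>)(s + v := 1), snd \<sigma>) (1 + s * (T + 2)) Q"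
    by simp
  then have "runs (for_loop v c) \<sigma> (1 + (1 + s * (T + 2))) Q"
    unfolding for_loop_def
    by (intro runs_Seq runs_NStore) (simp_all add: s cell_def)
  then show ?thesis by simp
qed

section \<open>The program\<close>

text \<open>\<open>C m\<close> is the colour of interval \<open>m\<close> and \<open>D c\<close> the size of colour class \<open>c\<close>; \<open>i\<close>, \<open>k\<close> and \<open>j\<close> are loop counters.\<close>

definition memory :: "nat \<Rightarrow> (nat \<Rightarrow> nat) \<Rightarrow> nat \<Rightarrow> nat \<Rightarrow> nat \<Rightarrow> (nat \<Rightarrow> nat) \<Rightarrow> (nat \<Rightarrow> nat) \<Rightarrow> nat \<Rightarrow> nat"
  where
  "memory s I i k j C D x =
     (if x = 0 then s else if x \<le> s then I x
      else if x = s + 1 then i else if x = s + 2 then k else if x = s + 3 then j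
      else if x \<le> 2 * s + 3 then C (x - (s + 3)) else D (x - (2 * s + 3)))"

lemma memory_load [simp]:
  "memory s I i k j C D 0 = s"
  "memory s I i k j C D (Suc s) = i"
  "memory s I i k j C D (Suc (Suc s)) = k"
  "memory s I i k j C D (s + 3) = j"
  "1 \<le> x \<Longrightarrow> x \<le> s \<Longrightarrow> memory s I i k j C D x = I x"
  "1 \<le> x \<Longrightarrow> x \<le> s \<Longrightarrow> memory s I i k j C D (s + 3 + x) = C x"
  "1 \<le> x \<Longrightarrow> memory s I i k j C D (2 * s + 3 + x) = D x"
  by (auto simp: memory_def)

text \<open>Writing stays within terms of the form \<open>memory\<close>, so execution only changes
  its arguments. The bounds on \<open>x\<close> keep an address inside its block; the block of class
  sizes comes last and is unbounded.\<close>

lemma memory_store [simp]: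
  "(memory s I i k j C D)(Suc s := n) = memory s I n k j C D"
  "(memory s I i k j C D)(Suc (Suc s) := n) = memory s I i n j C D"
  "(memory s I i k j C D)(s + 3 := n) = memory s I i k n C D"
  "1 \<le> x \<Longrightarrow> x \<le> s \<Longrightarrow> (memory s I i k j C D)(x := n) = memory s (I(x := n)) i k j C D"
  "1 \<le> x \<Longrightarrow> x \<le> s \<Longrightarrow> (memory s I i k j C D)(s + 3 + x := n) = memory s I i k j (C(x := n)) D"
  "1 \<le> x \<Longrightarrow> (memory s I i k j C D)(2 * s + 3 + x := n) = memory s I i k j C (D(x := n))"
  by (auto simp: memory_def fun_eq_iff)

text \<open>Colours lie directly above the last counter, which is in cell \<open>s + 3\<close>, and
  class sizes directly above the colours.\<close>

definition colour_cell :: "nexp \<Rightarrow> nexp" where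
  "colour_cell e = NPlus (cell 3) e"

definition size_cell :: "nexp \<Rightarrow> nexp" where
  "size_cell e = NPlus (NPlus (cell 3) (NLoad (NConst 0))) e"

text \<open>Equality and \<open>\<le>\<close> are negated strict comparisons, and doubling an index
  is an addition, because the language offers nothing else.\<close>

definition clash :: bexp where
  "clash =
     (let i = NLoad (cell 1); j = NLoad (cell 3);
          Ci = NLoad (colour_cell i); Cj = NLoad (colour_cell j)
      in BAnd (NLess j i)
        (BAnd (BNot (RLess (RLoad (NPlus (NPlus j j) (NConst 1))) (RLoad (NPlus i i))))
          (BAnd (BNot (NLess Ci Cj)) (BNot (NLess Cj Ci)))))"

text \<open>Raising the colour may hit the colour of an index already passed in this sweep, which is
  why sweeps are repeated.\<close>

definition colour_pass :: com where
  "colour_pass =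
     (let Ci = colour_cell (NLoad (cell 1))
      in for_loop 3 (Cond clash (NStore Ci (NPlus (NLoad Ci) (NConst 1))) Skip))"

definition colour_intervals :: com where
  "colour_intervals =
     for_loop 1 (Seq (NStore (colour_cell (NLoad (cell 1))) (NConst 1)) (for_loop 2 colour_pass))"

definition count_colours :: com where
  "count_colours =
     (let d = size_cell (NLoad (colour_cell (NLoad (cell 1))))
      in for_loop 1 (NStore d (NPlus (NLoad d) (NConst 1))))"

text \<open>The test negates \<open>precedes\<close>, as there is no disjunction, so counting
  happens in the second branch. Given \<open>Dk \<le> Di\<close> from the first conjunct, the
  negation of \<open>Dk < Di\<close> means equality. Output cell \<open>i\<close> itself serves as
  the tally.\<close>

definition rank_colours :: com where
  "rank_colours =
     (let i = NLoad (cell 1); k = NLoad (cell 2); Ci = NLoad (colour_cell i);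
          Dk = NLoad (size_cell k); Di = NLoad (size_cell Ci)
      in for_loop 1 (for_loop 2
        (Cond (BAnd (BNot (NLess Di Dk)) (BNot (BAnd (BNot (NLess Dk Di)) (BNot (NLess Ci k)))))
          Skip
          (NStore i (NPlus (NLoad i) (NConst 1))))))"

definition assign_intervals :: com where
  "assign_intervals = Seq colour_intervals (Seq count_colours rank_colours)"

section \<open>Correctness of the colouring phase\<close>

definition holds_instance :: "nat \<Rightarrow> (nat \<Rightarrow> real) \<Rightarrow> (nat \<Rightarrow> real) \<Rightarrow> (nat \<Rightarrow> real) \<Rightarrow> bool" where
  "holds_instance s a b r \<longleftrightarrow> (\<forall>i\<in>{1..s}. r (i + i) = a i \<and> r (Suc (i + i)) = b i)"

lemma bval_clash:
  assumes "interval_instance s a b" "holds_instance s a b r" "i \<in> {1..s}" "j \<in> {1..s}"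
  shows "bval clash (memory s I i k j C D, r) \<longleftrightarrow> j \<in> coverage s a b i - {i} \<and> C j = C i"
proof -
  have "r (i + i) = a i" "r (Suc (j + j)) = b j"
    using assms by (auto simp: holds_instance_def)
  moreover have "j \<in> coverage s a b i - {i} \<longleftrightarrow> j < i \<and> a i \<le> b j"
    using assms(4) coverage_eq[OF assms(1,3)] by auto
  ultimately show ?thesis
    using assms(3,4) by (auto simp: clash_def Let_def cell_def colour_cell_def)
qed

text \<open>
  After \<open>k\<close> passes either the colour of \<open>i\<close> is free or it has been incremented at least \<open>k\<close>
  times; as it never exceeds \<open>s\<close>, it is free after \<open>s\<close> passes.
\<close>

lemma runs_colour_pass:
  assumes inst: "interval_instance s a b" and r: "holds_instance s a b r"
    and i: "i \<in> {1..s}" and ff: "first_fit_at s a b C i"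
    and k: "free_at s a b C i \<or> k \<le> C i"
  shows "runs colour_pass (memory s I i k j C D, r) (2 + s * 4)
    (\<lambda>\<sigma>. \<exists>j n. \<sigma> = (memory s I i k j (C(i := n)) D, r) \<and> first_fit_at s a b (C(i := n)) i \<and>
      (free_at s a b (C(i := n)) i \<or> Suc k \<le> n))"
    (is "runs _ _ _ ?Q")
proof -
  define N where "N = coverage s a b i - {i}"
  have N: "N \<subseteq> {1..s}" by (auto simp: N_def coverage_def)
  \<comment> \<open>Invariant for the current colour \<open>n\<close> of \<open>i\<close> before
    index \<open>j\<close> is inspected in pass \<open>k\<close>: \<open>n\<close> is free, or
    already above \<open>k\<close>, or equal to \<open>k\<close> with no clash seen so far in this
    pass.\<close>
  define good where
    "good j n \<longleftrightarrow> 1 \<le> n \<and> {1..<n} \<subseteq> C ` N \<and> (n \<notin> C ` N \<or> k < n \<or> n = k \<and> n \<notin> C ` (N \<inter> {..<j}))" for j n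
  have upd: "(C(i := n)) ` N = C ` N" for n by (auto simp: N_def)
  have ff_upd: "first_fit_at s a b (C(i := n)) i \<longleftrightarrow> 1 \<le> n \<and> {1..<n} \<subseteq> C ` N" for n
    unfolding first_fit_at_def N_def[symmetric] upd by simp
  have free_upd: "free_at s a b (C(i := n)) i \<longleftrightarrow> n \<notin> C ` N" for n
    unfolding free_at_def N_def[symmetric] upd by simp
  \<comment> \<open>A clash rules out that \<open>n\<close> is free, so \<open>k \<le> n\<close>; it
    also shows that \<open>n\<close> is taken, so raising to \<open>Suc n\<close> preserves
    first-fit.\<close>
  have good_Suc: "good (Suc j) (Suc n)" if "good j n" "j \<in> N" "C j = n" for j n
    using that by (auto simp: good_def atLeastLessThanSuc)
  have good_same: "good (Suc j) n" if "good j n" "\<not> (j \<in> N \<and> C j = n)" for j n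
    using that by (auto simp: good_def lessThan_Suc)
  \<comment> \<open>After a full sweep, having seen no clash means that the colour is free.\<close>
  have "N \<inter> {..<Suc s} = N" using N by auto
  then have good_final: "n \<notin> C ` N \<or> Suc k \<le> n" if "good (Suc s) n" for n
    using that by (auto simp: good_def)
  let ?Inv = "\<lambda>j \<sigma>. \<exists>n. \<sigma> = (memory s I i k j (C(i := n)) D, r) \<and> good j n"
  let ?Ci = "colour_cell (NLoad (cell 1))"
  have "runs (for_loop 3 (Cond clash (NStore ?Ci (NPlus (NLoad ?Ci) (NConst 1))) Skip))
    (memory s I i k j C D, r) (2 + s * (2 + 2)) ?Q"
  proof (rule runs_for_loop[where Inv = ?Inv and s = s])
    have "1 \<le> C i \<and> {1..<C i} \<subseteq> C ` N" "C i \<notin> C ` N \<or> k \<le> C i"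
      using ff k by (simp_all add: first_fit_at_def free_at_def N_def)
    moreover have "N \<inter> {..<1} = {}" using N by auto
    ultimately have "good 1 (C i)" unfolding good_def by auto
    then show "?Inv 1 ((fst (memory s I i k j C D, r))(s + 3 := 1), snd (memory s I i k j C D, r))"
      by (intro exI[of _ "C i"]) simp
  next
    fix j \<tau> assume j: "1 \<le> j" "j \<le> s" and "?Inv j \<tau>"
    then obtain n where \<tau>: "\<tau> = (memory s I i k j (C(i := n)) D, r)" and n: "good j n"
      by blast
    have g: "bval clash \<tau> \<longleftrightarrow> j \<in> N \<and> C j = n"
      unfolding \<tau> using bval_clash[OF inst r i, of j] j by (auto simp: N_def)
    have "runs (Cond clash (NStore ?Ci (NPlus (NLoad ?Ci) (NConst 1))) Skip) \<tau> (1 + 1)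
      (\<lambda>\<tau>'. \<exists>n. \<tau>' = (memory s I i k j (C(i := n)) D, r) \<and> good (Suc j) n)"
    proof (rule runs_Cond)
      assume "bval clash \<tau>"
      then have "good (Suc j) (Suc n)" using g n good_Suc by blast
      then show "runs (NStore ?Ci (NPlus (NLoad ?Ci) (NConst 1))) \<tau> 1
        (\<lambda>\<tau>'. \<exists>n. \<tau>' = (memory s I i k j (C(i := n)) D, r) \<and> good (Suc j) n)"
        using i by (intro runs_NStore exI[of _ "Suc n"]) (auto simp: \<tau> cell_def colour_cell_def)
    next
      assume "\<not> bval clash \<tau>"
      then have "good (Suc j) n" using g n good_same by blast
      then show "runs Skip \<tau> 1 (\<lambda>\<tau>'. \<exists>n. \<tau>' = (memory s I i k j (C(i := n)) D, r) \<and> good (Suc j) n)"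
        using \<tau> by (intro runs_Skip) auto
    qed
    then show "runs (Cond clash (NStore ?Ci (NPlus (NLoad ?Ci) (NConst 1))) Skip) \<tau> 2
      (\<lambda>\<tau>'. fst \<tau>' 0 = s \<and> fst \<tau>' (s + 3) = j \<and> ?Inv (Suc j) ((fst \<tau>')(s + 3 := Suc j), snd \<tau>'))"
      by (rule runs_mono) auto
  next
    fix \<sigma> assume "?Inv (Suc s) \<sigma>"
    then obtain n where "\<sigma> = (memory s I i k (Suc s) (C(i := n)) D, r)" "good (Suc s) n" by blast
    moreover from this(2) have "first_fit_at s a b (C(i := n)) i" by (simp add: ff_upd good_def)
    ultimately show "?Q \<sigma>" using good_final free_upd by blast
  qed auto
  then show ?thesis by (simp add: colour_pass_def Let_def)
qed

lemma runs_colour_cell: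
  assumes inst: "interval_instance s a b" and r: "holds_instance s a b r" and i: "i \<in> {1..s}"
  shows "runs (Seq (NStore (colour_cell (NLoad (cell 1))) (NConst 1)) (for_loop 2 colour_pass))
    (memory s I i k j C D, r) (1 + (2 + s * (2 + s * 4 + 2)))
    (\<lambda>\<sigma>. \<exists>k j n. \<sigma> = (memory s I i k j (C(i := n)) D, r) \<and>
      first_fit_at s a b (C(i := n)) i \<and> free_at s a b (C(i := n)) i)"
    (is "runs _ _ _ ?Q")
proof -
  let ?ok = "\<lambda>k n. first_fit_at s a b (C(i := n)) i \<and> (free_at s a b (C(i := n)) i \<or> k \<le> n)"
  let ?Inv = "\<lambda>k \<sigma>. \<exists>j n. \<sigma> = (memory s I i k j (C(i := n)) D, r) \<and> ?ok k n"
  have "runs (for_loop 2 colour_pass) (memory s I i k j (C(i := 1)) D, r) (2 + s * (2 + s * 4 + 2)) ?Q"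
  proof (rule runs_for_loop[where Inv = ?Inv and s = s])
    show "?Inv 1 ((fst (memory s I i k j (C(i := 1)) D, r))(s + 2 := 1),
        snd (memory s I i k j (C(i := 1)) D, r))"
      by (intro exI[of _ j] exI[of _ 1]) (auto simp: first_fit_at_def)
  next
    fix k \<tau> assume "?Inv k \<tau>"
    then obtain j n where \<tau>: "\<tau> = (memory s I i k j (C(i := n)) D, r)" and n: "?ok k n" by blast
    have "free_at s a b (C(i := n)) i \<or> k \<le> (C(i := n)) i" using n by auto
    from runs_colour_pass[OF inst r i conjunct1[OF n] this, of I j D]
    show "runs colour_pass \<tau> (2 + s * 4)
      (\<lambda>\<tau>'. fst \<tau>' 0 = s \<and> fst \<tau>' (s + 2) = k \<and> ?Inv (Suc k) ((fst \<tau>')(s + 2 := Suc k), snd \<tau>'))"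
      unfolding \<tau>
    proof (rule runs_mono)
      fix \<sigma>
      assume "\<exists>j n'. \<sigma> = (memory s I i k j (C(i := n, i := n')) D, r) \<and>
        first_fit_at s a b (C(i := n, i := n')) i \<and> (free_at s a b (C(i := n, i := n')) i \<or> Suc k \<le> n')"
      then obtain j n where "\<sigma> = (memory s I i k j (C(i := n)) D, r)" "?ok (Suc k) n" by auto
      then show "fst \<sigma> 0 = s \<and> fst \<sigma> (s + 2) = k \<and> ?Inv (Suc k) ((fst \<sigma>)(s + 2 := Suc k), snd \<sigma>)"
        by (intro conjI exI[of _ j] exI[of _ n]) auto
    qed simp
  next
    fix \<sigma> assume "?Inv (Suc s) \<sigma>"
    then obtain j n where "\<sigma> = (memory s I i (Suc s) j (C(i := n)) D, r)" and n: "?ok (Suc s) n" by blast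
    \<comment> \<open>This excludes the alternative \<open>Suc s \<le> n\<close>, so the colour is
      free after \<open>s\<close> passes.\<close>
    moreover have "n \<le> s"
      using first_fit_at_le_card_coverage(2)[OF inst i conjunct1[OF n]] by simp
    ultimately show "?Q \<sigma>" using n by fastforce
  qed auto
  then show ?thesis
    using i by (intro runs_Seq runs_NStore) (simp_all add: cell_def colour_cell_def)
qed

lemma runs_colour_intervals:
  assumes inst: "interval_instance s a b" and r: "holds_instance s a b r"
  shows "runs colour_intervals (memory s I i k j C D, r) (2 + s * (1 + (2 + s * (2 + s * 4 + 2)) + 2))
    (\<lambda>\<sigma>. \<exists>i k j C. \<sigma> = (memory s I i k j C D, r) \<and>
      (\<forall>m\<in>{1..s}. first_fit_at s a b C m \<and> free_at s a b C m))"
  unfolding colour_intervals_def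
proof -
  let ?ok = "\<lambda>C m. first_fit_at s a b C m \<and> free_at s a b C m"
  let ?Inv = "\<lambda>i \<sigma>. \<exists>k j C. \<sigma> = (memory s I i k j C D, r) \<and> (\<forall>m\<in>{1..<i}. ?ok C m)"
  let ?c = "Seq (NStore (colour_cell (NLoad (cell 1))) (NConst 1)) (for_loop 2 colour_pass)"
  show "runs (for_loop 1 ?c) (memory s I i k j C D, r) (2 + s * (1 + (2 + s * (2 + s * 4 + 2)) + 2))
    (\<lambda>\<sigma>. \<exists>i k j C. \<sigma> = (memory s I i k j C D, r) \<and> (\<forall>m\<in>{1..s}. ?ok C m))"
  proof (rule runs_for_loop[where Inv = ?Inv and s = s])
    show "?Inv 1 ((fst (memory s I i k j C D, r))(s + 1 := 1), snd (memory s I i k j C D, r))"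
      by auto
    show "fst \<tau> 0 = s \<and> fst \<tau> (s + 1) = i" if "?Inv i \<tau>" for i \<tau> using that by auto
    show "\<exists>i k j C. \<tau> = (memory s I i k j C D, r) \<and> (\<forall>m\<in>{1..s}. ?ok C m)"
      if "?Inv (Suc s) \<tau>" for \<tau>
      using that by (auto simp: atLeastLessThanSuc_atLeastAtMost)
    fix i \<tau> assume i: "1 \<le> i" "i \<le> s" and "?Inv i \<tau>"
    then obtain k j C where \<tau>: "\<tau> = (memory s I i k j C D, r)" and C: "\<forall>m\<in>{1..<i}. ?ok C m" by blast
    \<comment> \<open>Recolouring \<open>i\<close> cannot spoil an earlier index \<open>m\<close>,
      since \<open>i\<close> does not belong to the coverage set of \<open>m\<close>.\<close>
    have keep: "?ok (C(i := n)) m" if m: "m \<in> {1..<i}" for m n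
    proof -
      have "i \<notin> coverage s a b m" using m i coverage_eq[OF inst, of m] by auto
      then have "(C(i := n)) ` (coverage s a b m - {m}) = C ` (coverage s a b m - {m})"
        by (intro image_cong) auto
      then show ?thesis using C m by (auto simp: first_fit_at_def free_at_def)
    qed
    have "i \<in> {1..s}" using i by simp
    from runs_colour_cell[OF inst r this, of I k j C D]
    show "runs (Seq (NStore (colour_cell (NLoad (cell 1))) (NConst 1)) (for_loop 2 colour_pass)) \<tau>
      (1 + (2 + s * (2 + s * 4 + 2)))
      (\<lambda>\<tau>'. fst \<tau>' 0 = s \<and> fst \<tau>' (s + 1) = i \<and> ?Inv (Suc i) ((fst \<tau>')(s + 1 := Suc i), snd \<tau>'))"
      unfolding \<tau>
    proof (rule runs_mono)
      fix \<sigma>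
      assume "\<exists>k j n. \<sigma> = (memory s I i k j (C(i := n)) D, r) \<and> ?ok (C(i := n)) i"
      then obtain k j n where \<sigma>: "\<sigma> = (memory s I i k j (C(i := n)) D, r)" "?ok (C(i := n)) i" by blast
      have "\<forall>m\<in>{1..<Suc i}. ?ok (C(i := n)) m"
        using keep \<sigma>(2) i by (auto simp: atLeastLessThanSuc)
      then show "fst \<sigma> 0 = s \<and> fst \<sigma> (s + 1) = i \<and> ?Inv (Suc i) ((fst \<sigma>)(s + 1 := Suc i), snd \<sigma>)"
        using \<sigma>(1) by auto
    qed simp
  qed auto
qed

section \<open>Counting class sizes and ranking colours\<close>

lemma runs_count_colours:
  assumes C: "\<And>i. i \<in> {1..s} \<Longrightarrow> 1 \<le> C i"
  shows "runs count_colours (memory s I i k j C (\<lambda>_. 0), r) (2 + s * (1 + 2))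
    (\<lambda>\<sigma>. \<exists>i. \<sigma> = (memory s I i k j C (class_size s C), r))"
  unfolding count_colours_def Let_def
proof -
  \<comment> \<open>Class sizes restricted to the indices already processed; at \<open>i = 1\<close>
    they vanish, matching the zero cells at the start.\<close>
  let ?D = "\<lambda>i c. card {m \<in> {1..<i}. C m = c}"
  let ?Inv = "\<lambda>i \<sigma>. \<sigma> = (memory s I i k j C (?D i), r)"
  let ?d = "size_cell (NLoad (colour_cell (NLoad (cell 1))))"
  show "runs (for_loop 1 (NStore ?d (NPlus (NLoad ?d) (NConst 1)))) (memory s I i k j C (\<lambda>_. 0), r)
    (2 + s * (1 + 2)) (\<lambda>\<sigma>. \<exists>i. \<sigma> = (memory s I i k j C (class_size s C), r))"
  proof (rule runs_for_loop[where Inv = ?Inv and s = s])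
    show "?Inv 1 ((fst (memory s I i k j C (\<lambda>_. 0), r))(s + 1 := 1), snd (memory s I i k j C (\<lambda>_. 0), r))"
      by simp
    show "fst \<tau> 0 = s \<and> fst \<tau> (s + 1) = i" if "?Inv i \<tau>" for i \<tau> using that by auto
    show "\<exists>i. \<tau> = (memory s I i k j C (class_size s C), r)" if "?Inv (Suc s) \<tau>" for \<tau>
      using that by (auto simp: atLeastLessThanSuc_atLeastAtMost class_size_def[abs_def])
    fix i \<tau> assume i: "1 \<le> i" "i \<le> s" and \<tau>: "?Inv i \<tau>"
    have "{m \<in> {1..<Suc i}. C m = c} =
        (if C i = c then insert i {m \<in> {1..<i}. C m = c} else {m \<in> {1..<i}. C m = c})" for c
      using i by (auto simp: less_Suc_eq)
    then have "(?D i)(C i := Suc (?D i (C i))) = ?D (Suc i)"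
      by (auto simp: fun_eq_iff)
    then show "runs (NStore ?d (NPlus (NLoad ?d) (NConst 1))) \<tau> 1
        (\<lambda>\<tau>'. fst \<tau>' 0 = s \<and> fst \<tau>' (s + 1) = i \<and> ?Inv (Suc i) ((fst \<tau>')(s + 1 := Suc i), snd \<tau>'))"
      using i C[of i] by (intro runs_NStore) (simp_all add: \<tau> cell_def colour_cell_def size_cell_def)
  qed auto
qed

lemma runs_rank_colours:
  assumes C: "\<And>i. i \<in> {1..s} \<Longrightarrow> C i \<in> {1..s}"
  shows "runs rank_colours (memory s (\<lambda>_. 0) i k j C (class_size s C), r)
    (2 + s * (2 + s * (2 + 2) + 2))
    (\<lambda>\<sigma>. \<exists>I i k. \<sigma> = (memory s I i k j C (class_size s C), r) \<and>
      (\<forall>m\<in>{1..s}. I m = colour_rank s C (C m)))"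
proof -
  let ?D = "class_size s C"
  let ?inc = "NStore (NLoad (cell 1)) (NPlus (NLoad (NLoad (cell 1))) (NConst 1))"
  let ?Ci = "NLoad (colour_cell (NLoad (cell 1)))"
  let ?g = "BAnd (BNot (NLess (NLoad (size_cell ?Ci)) (NLoad (size_cell (NLoad (cell 2))))))
    (BNot (BAnd (BNot (NLess (NLoad (size_cell (NLoad (cell 2)))) (NLoad (size_cell ?Ci))))
      (BNot (NLess ?Ci (NLoad (cell 2))))))"
  have inner: "runs (for_loop 2 (Cond ?g Skip ?inc)) (memory s I i k j C ?D, r) (2 + s * (2 + 2))
      (\<lambda>\<sigma>. \<exists>k. \<sigma> = (memory s (I(i := colour_rank s C (C i))) i k j C ?D, r))"
    if i: "i \<in> {1..s}" and zero: "I i = 0" for I i k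
  proof -
    let ?n = "\<lambda>k. card {l \<in> {1..<k}. precedes s C l (C i)}"
    let ?Inv = "\<lambda>k \<sigma>. \<sigma> = (memory s (I(i := ?n k)) i k j C ?D, r)"
    show ?thesis
    proof (rule runs_for_loop[where Inv = ?Inv and s = s])
      show "?Inv 1 ((fst (memory s I i k j C ?D, r))(s + 2 := 1), snd (memory s I i k j C ?D, r))"
        using zero by (simp add: fun_upd_idem)
      show "fst \<tau> 0 = s \<and> fst \<tau> (s + 2) = k" if "?Inv k \<tau>" for k \<tau> using that by auto
      show "\<exists>k. \<tau> = (memory s (I(i := colour_rank s C (C i))) i k j C ?D, r)"
        if "?Inv (Suc s) \<tau>" for \<tau>
        using that by (auto simp: atLeastLessThanSuc_atLeastAtMost colour_rank_def)
      fix k \<tau> assume k: "1 \<le> k" "k \<le> s" and \<tau>: "?Inv k \<tau>"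
      have Ci: "1 \<le> C i" "C i \<le> s" using C[OF i] by auto
      have g: "bval ?g \<tau> \<longleftrightarrow> \<not> precedes s C k (C i)"
        using i k Ci by (auto simp: \<tau> cell_def colour_cell_def size_cell_def precedes_def)
      have "{l \<in> {1..<Suc k}. precedes s C l (C i)} =
          (if precedes s C k (C i) then insert k {l \<in> {1..<k}. precedes s C l (C i)}
           else {l \<in> {1..<k}. precedes s C l (C i)})"
        using k by (auto simp: less_Suc_eq)
      then have n: "?n (Suc k) = (if precedes s C k (C i) then Suc (?n k) else ?n k)" by simp
      have "runs (Cond ?g Skip ?inc) \<tau> (1 + 1)
        (\<lambda>\<tau>'. \<tau>' = (memory s (I(i := ?n (Suc k))) i k j C ?D, r))"
      proof (rule runs_Cond)
        assume "bval ?g \<tau>"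
        then have "\<not> precedes s C k (C i)" using g by blast
        then have "?n (Suc k) = ?n k" unfolding n by simp
        then show "runs Skip \<tau> 1 (\<lambda>\<tau>'. \<tau>' = (memory s (I(i := ?n (Suc k))) i k j C ?D, r))"
          using \<tau> by (intro runs_Skip) simp_all
      next
        assume "\<not> bval ?g \<tau>"
        then have "precedes s C k (C i)" using g by blast
        then have "?n (Suc k) = Suc (?n k)" unfolding n by simp
        then show "runs ?inc \<tau> 1 (\<lambda>\<tau>'. \<tau>' = (memory s (I(i := ?n (Suc k))) i k j C ?D, r))"
          using i by (intro runs_NStore) (simp_all add: \<tau> cell_def)
      qed
      then show "runs (Cond ?g Skip ?inc) \<tau> 2
        (\<lambda>\<tau>'. fst \<tau>' 0 = s \<and> fst \<tau>' (s + 2) = k \<and> ?Inv (Suc k) ((fst \<tau>')(s + 2 := Suc k), snd \<tau>'))"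
        by (rule runs_mono) simp_all
    qed auto
  qed
  \<comment> \<open>Cells not yet processed are kept at 0, because the inner loop counts up from the
    value it finds there.\<close>
  let ?ok = "\<lambda>I i. (\<forall>m\<in>{1..<i}. I m = colour_rank s C (C m)) \<and> (\<forall>m\<ge>i. I m = 0)"
  let ?Inv = "\<lambda>i \<sigma>. \<exists>I k. \<sigma> = (memory s I i k j C ?D, r) \<and> ?ok I i"
  have "runs (for_loop 1 (for_loop 2 (Cond ?g Skip ?inc))) (memory s (\<lambda>_. 0) i k j C ?D, r)
    (2 + s * (2 + s * (2 + 2) + 2))
    (\<lambda>\<sigma>. \<exists>I i k. \<sigma> = (memory s I i k j C ?D, r) \<and> (\<forall>m\<in>{1..s}. I m = colour_rank s C (C m)))"
  proof (rule runs_for_loop[where Inv = ?Inv and s = s])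
    show "?Inv 1 ((fst (memory s (\<lambda>_. 0) i k j C ?D, r))(s + 1 := 1),
        snd (memory s (\<lambda>_. 0) i k j C ?D, r))"
      by (intro exI[of _ "\<lambda>_. 0"] exI[of _ k]) simp
    show "fst \<tau> 0 = s \<and> fst \<tau> (s + 1) = i" if "?Inv i \<tau>" for i \<tau> using that by auto
    show "\<exists>I i k. \<tau> = (memory s I i k j C ?D, r) \<and> (\<forall>m\<in>{1..s}. I m = colour_rank s C (C m))"
      if "?Inv (Suc s) \<tau>" for \<tau>
      using that unfolding atLeastLessThanSuc_atLeastAtMost by blast
    fix i \<tau> assume i: "1 \<le> i" "i \<le> s" and "?Inv i \<tau>"
    then obtain I k where \<tau>: "\<tau> = (memory s I i k j C ?D, r)" and I: "?ok I i" by blast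
    have "i \<in> {1..s}" "I i = 0" using i I by auto
    from inner[of i I, OF this]
    show "runs (for_loop 2 (Cond ?g Skip ?inc)) \<tau> (2 + s * (2 + 2))
      (\<lambda>\<tau>'. fst \<tau>' 0 = s \<and> fst \<tau>' (s + 1) = i \<and> ?Inv (Suc i) ((fst \<tau>')(s + 1 := Suc i), snd \<tau>'))"
      unfolding \<tau>
    proof (rule runs_mono)
      fix \<sigma> assume "\<exists>k. \<sigma> = (memory s (I(i := colour_rank s C (C i))) i k j C ?D, r)"
      then obtain k where \<sigma>: "\<sigma> = (memory s (I(i := colour_rank s C (C i))) i k j C ?D, r)" by blast
      have "?ok (I(i := colour_rank s C (C i))) (Suc i)" using I by (auto simp: less_Suc_eq)
      then have "?Inv (Suc i) (memory s (I(i := colour_rank s C (C i))) (Suc i) k j C ?D, r)" by blast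
      then show "fst \<sigma> 0 = s \<and> fst \<sigma> (s + 1) = i \<and> ?Inv (Suc i) ((fst \<sigma>)(s + 1 := Suc i), snd \<sigma>)"
        unfolding \<sigma> by simp
    qed simp
  qed auto
  then show ?thesis by (simp add: rank_colours_def Let_def)
qed

section \<open>The whole program on the input\<close>

lemma input_state_memory:
  "input_state s a b = (memory s (\<lambda>_. 0) 0 0 0 (\<lambda>_. 0) (\<lambda>_. 0), snd (input_state s a b))"
  by (auto simp: input_state_def memory_def fun_eq_iff)

lemma holds_instance_input_state: "holds_instance s a b (snd (input_state s a b))"
proof -
  have "even (i + i)" "(i + i) div 2 = i" "odd (Suc (i + i))" "Suc (i + i) div 2 = i" for i :: nat
    by presburger+
  then show ?thesis by (simp add: holds_instance_def input_state_def)
qed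

lemma runs_assign_intervals:
  assumes inst: "interval_instance s a b"
  shows "runs assign_intervals (input_state s a b)
    (2 + s * (1 + (2 + s * (2 + s * 4 + 2)) + 2) + (2 + s * (1 + 2) + (2 + s * (2 + s * (2 + 2) + 2))))
    (\<lambda>\<sigma>. \<exists>C. \<forall>i\<in>{1..s}. first_fit_at s a b C i \<and> free_at s a b C i \<and>
      assignment \<sigma> i = colour_rank s C (C i))"
    (is "runs _ _ _ ?Q")
  unfolding assign_intervals_def
proof (rule runs_Seq)
  define r where "r = snd (input_state s a b)"
  have init: "input_state s a b = (memory s (\<lambda>_. 0) 0 0 0 (\<lambda>_. 0) (\<lambda>_. 0), r)"
    unfolding r_def by (rule input_state_memory)
  have "runs colour_intervals (memory s (\<lambda>_. 0) 0 0 0 (\<lambda>_. 0) (\<lambda>_. 0), r)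
    (2 + s * (1 + (2 + s * (2 + s * 4 + 2)) + 2))
    (\<lambda>\<sigma>. \<exists>i k j C. \<sigma> = (memory s (\<lambda>_. 0) i k j C (\<lambda>_. 0), r) \<and>
      (\<forall>m\<in>{1..s}. first_fit_at s a b C m \<and> free_at s a b C m))"
    unfolding r_def by (rule runs_colour_intervals[OF inst holds_instance_input_state])
  then show "runs colour_intervals (input_state s a b) (2 + s * (1 + (2 + s * (2 + s * 4 + 2)) + 2))
    (\<lambda>\<sigma>. runs (Seq count_colours rank_colours) \<sigma>
      (2 + s * (1 + 2) + (2 + s * (2 + s * (2 + 2) + 2))) ?Q)"
    unfolding init
  proof (rule runs_mono)
    fix \<sigma>
    assume "\<exists>i k j C. \<sigma> = (memory s (\<lambda>_. 0) i k j C (\<lambda>_. 0), r) \<and>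
      (\<forall>m\<in>{1..s}. first_fit_at s a b C m \<and> free_at s a b C m)"
    then obtain i k j C where \<sigma>: "\<sigma> = (memory s (\<lambda>_. 0) i k j C (\<lambda>_. 0), r)"
      and ok: "\<forall>m\<in>{1..s}. first_fit_at s a b C m \<and> free_at s a b C m" by blast
    have pos: "1 \<le> C m" if "m \<in> {1..s}" for m
      using ok that by (simp add: first_fit_at_def)
    \<comment> \<open>First-fit colours never exceed \<open>s\<close>, so the ranking loop over
      \<open>1..s\<close> meets every colour in use.\<close>
    then have C: "C m \<in> {1..s}" if "m \<in> {1..s}" for m
      using ok that first_fit_at_le_card_coverage(2)[OF inst] by simp
    show "runs (Seq count_colours rank_colours) \<sigma>
      (2 + s * (1 + 2) + (2 + s * (2 + s * (2 + 2) + 2))) ?Q"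
      unfolding \<sigma>
    proof (rule runs_Seq, rule runs_mono[OF runs_count_colours[of s C, OF pos]])
      fix \<tau> assume "\<exists>i. \<tau> = (memory s (\<lambda>_. 0) i k j C (class_size s C), r)"
      then obtain i where \<tau>: "\<tau> = (memory s (\<lambda>_. 0) i k j C (class_size s C), r)" by blast
      show "runs rank_colours \<tau> (2 + s * (2 + s * (2 + 2) + 2)) ?Q"
        unfolding \<tau> by (rule runs_mono[OF runs_rank_colours[of s C, OF C]])
          (use ok in \<open>auto simp: assignment_def\<close>)
    qed simp_all
  qed simp
qed

theorem lemma2:
  shows "\<exists>(algorithm :: com) (p :: nat poly). \<forall>s a b. interval_instance s a b \<longrightarrow>
    (\<exists>t \<sigma>. exec algorithm (input_state s a b) t \<sigma> \<and> t \<le> poly p s \<and>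
      (\<forall>i\<in>{1..s}. assignment \<sigma> i \<ge> 1) \<and>
      local_dominance s a b (assignment \<sigma>) \<and>
      global_dominance s a b (assignment \<sigma>) \<and>
      partition_monotonicity s (assignment \<sigma>))"
\<comment> \<open>The polynomial \<open>6 + 12 s + 8 s^2 + 4 s^3\<close> sums the bounds
  \<open>2 + 5 s + 4 s^2 + 4 s^3\<close>, \<open>2 + 3 s\<close> and \<open>2 + 4 s + 4 s^2\<close>
  for colouring, counting and ranking.\<close>
proof (intro exI[of _ assign_intervals] exI[of _ "[:6, 12, 8, 4:]"] allI impI)
  fix s a b assume inst: "interval_instance s a b"
  obtain t \<sigma> C where "exec assign_intervals (input_state s a b) t \<sigma>"
    and t: "t \<le> 2 + s * (1 + (2 + s * (2 + s * 4 + 2)) + 2) + (2 + s * (1 + 2) + (2 + s * (2 + s * (2 + 2) + 2)))"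
    and "\<And>i. i \<in> {1..s} \<Longrightarrow> first_fit_at s a b C i" "\<And>i. i \<in> {1..s} \<Longrightarrow> free_at s a b C i"
      "\<And>i. i \<in> {1..s} \<Longrightarrow> assignment \<sigma> i = colour_rank s C (C i)"
    using runs_assign_intervals[OF inst] unfolding runs_def by blast
  moreover have "t \<le> poly [:6, 12, 8, 4:] s"
    using t by (simp add: algebra_simps)
  ultimately show "\<exists>t \<sigma>. exec assign_intervals (input_state s a b) t \<sigma> \<and> t \<le> poly [:6, 12, 8, 4:] s \<and>
      (\<forall>i\<in>{1..s}. 1 \<le> assignment \<sigma> i) \<and> local_dominance s a b (assignment \<sigma>) \<and>
      global_dominance s a b (assignment \<sigma>) \<and> partition_monotonicity s (assignment \<sigma>)"
    using dominance_relabelled[OF inst, of C "assignment \<sigma>"] by blast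
qed

end
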